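(* Let $(\mathcal X,\mathscr F,\widehat{\mathbb P})$ be a probability space. The interchangeability principle (IP) holds for all $(\mathscr F\otimes\mathscr F)$-measurable diagonally dominant functions $\phi:\mathcal X\times\mathcal X\to\mathbb R\cup\{-\infty\}$ if and only if $(\mathcal X,\mathscr F,\widehat{\mathbb P})$ satisfies the following two conditions: (Proj) [Measurable projection] For any diagonally dominant set $A\in\mathscr F\otimes\mathscr F$, $$\mathrm{Proj}_{\hat x}(A):=\{\hat x\in\mathcal X:(\hat x,x)\in A\text{ for some }x\in\mathcal X\}\in\mathscr F_{\widehat{\mathbb P}}.$$ (Sel* ) [Weak measurable selection] For any diagonally dominant set-valued function $E:\mathcal X\to\mathscr F\setminus\{\varnothing\}$ with measurable graph $$\mathrm{Graph}(E):=\{(\hat x,x)\in\mathcal X\times\mathcal X:x\in E(\hat x)\}\in\mathscr F\otimes\mathscr F,$$ there exists a probability measure $\gamma\in\Gamma_{\widehat{\mathbb P}}$ such that $\mathrm{supp}\,\gamma\subset\mathrm{Graph}(E)$.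
   Context: $\mathscr F_{\widehat{\mathbb P}}$ is the completion of $\mathscr F$ under $\widehat{\mathbb P}$; a function is $\widehat{\mathbb P}$-measurable if it is $\mathscr F_{\widehat{\mathbb P}}$-measurable. $\Gamma_{\widehat{\mathbb P}}$ is the set of probability measures on $(\mathcal X\times\mathcal X,\mathscr F\otimes\mathscr F)$ with first marginal $\widehat{\mathbb P}$. For $B\in\mathscr F\otimes\mathscr F$, $\mathrm{supp}\,\gamma\subset B$ means that $\gamma$ is concentrated on $B$, i.e. $\gamma(B)=1$. Expectations may take values in $\overline{\mathbb R}$; an integral is well defined when the positive or the negative part of the integrand has finite integral. Interchangeability principle (IP): an $(\mathscr F\otimes\mathscr F)$-measurable $\phi:\mathcal X\times\mathcal X\to\mathbb R\cup\{-\infty\}$ satisfies (IP) if $\hat x\mapsto\sup_{x\in\mathcal X}\phi(\hat x,x)$ is $\widehat{\mathbb P}$-measurable and $$\mathbb E_{\widehat X\sim\widehat{\mathbb P}}\Big[\sup_{x\in\mathcal X}\phi(\widehat X,x)\Big]=\sup_{\gamma\in\Gamma_{\widehat{\mathbb P}}}\mathbb E_{(\widehat X,X)\sim\gamma}[\phi(\widehat X,X)].$$ Diagonal dominance: an $(\mathscr F\otimes\mathscr F)$-measurable function $\phi:\mathcal X\times\mathcal X\to\mathbb R\cup\{-\infty\}$ is diagonally dominant if $\phi(\hat x,x)\le\phi(x,x)$ for all $\hat x,x\in\mathcal X$. A set $A\in\mathscr F\otimes\mathscr F$ is diagonally dominant if $(\hat x,x)\in A$ implies $(x,x)\in A$.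 A set-valued function $E:\mathcal X\to\mathscr F\setminus\{\varnothing\}$ with $(\mathscr F\otimes\mathscr F)$-measurable graph is diagonally dominant if $x\in E(\hat x)$ implies $x\in E(x)$. *)

theory Defs
  imports "HOL-Probability.Probability"
begin

(* The library's Lebesgue integral covers ennreal-valued and Banach-valued integrands only.
   Since e2ennreal sends negative values to 0, e2ennreal (f x) is the positive part of f x and
   e2ennreal (- f x) the negative part. *)

definition integral_well_defined :: "'a measure \<Rightarrow> ('a \<Rightarrow> ereal) \<Rightarrow> bool" where
  "integral_well_defined M f \<longleftrightarrow>
     (\<integral>\<^sup>+ x. e2ennreal (f x) \<partial>M) < \<infinity> \<or> (\<integral>\<^sup>+ x. e2ennreal (- f x) \<partial>M) < \<infinity>"

(* Used only where integral_well_defined M f holds; otherwise the difference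
   \<infinity> - \<infinity> has no meaning. *)
definition ereal_expectation :: "'a measure \<Rightarrow> ('a \<Rightarrow> ereal) \<Rightarrow> ereal" where
  "ereal_expectation M f =
     enn2ereal (\<integral>\<^sup>+ x. e2ennreal (f x) \<partial>M) - enn2ereal (\<integral>\<^sup>+ x. e2ennreal (- f x) \<partial>M)"

definition first_marginal_measures :: "'a measure \<Rightarrow> ('a \<times> 'a) measure set" where
  "first_marginal_measures P =
     {\<gamma>. prob_space \<gamma> \<and> sets \<gamma> = sets (P \<Otimes>\<^sub>M P) \<and> distr \<gamma> P fst = P}"

definition concentrated_on :: "'a measure \<Rightarrow> 'a set \<Rightarrow> bool" where
  "concentrated_on \<gamma> B \<longleftrightarrow> emeasure \<gamma> B = 1"

(* The measurability requirement is unconditional. The identity is between well-defined integrals: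
   it is asserted whenever the expectation of the pointwise supremum is well defined, and the
   outer supremum ranges over those \<gamma> for which the expectation of \<phi> is well defined.
   The pointwise supremum is only measurable for the completion of P, hence is integrated
   against that completion. *)
definition interchangeable :: "'a measure \<Rightarrow> ('a \<Rightarrow> 'a \<Rightarrow> ereal) \<Rightarrow> bool" where
  "interchangeable P \<phi> \<longleftrightarrow>
     (\<lambda>xh. SUP x\<in>space P. \<phi> xh x) \<in> borel_measurable (completion P) \<and>
     (integral_well_defined (completion P) (\<lambda>xh. SUP x\<in>space P. \<phi> xh x) \<longrightarrow>
        ereal_expectation (completion P) (\<lambda>xh. SUP x\<in>space P. \<phi> xh x) =
        (SUP \<gamma>\<in>{\<gamma> \<in> first_marginal_measures P. integral_well_defined \<gamma> (\<lambda>(xh, x). \<phi> xh x)}.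
           ereal_expectation \<gamma> (\<lambda>(xh, x). \<phi> xh x)))"

definition diag_dominant_fun :: "'a measure \<Rightarrow> ('a \<Rightarrow> 'a \<Rightarrow> ereal) \<Rightarrow> bool" where
  "diag_dominant_fun P \<phi> \<longleftrightarrow>
     (\<lambda>(xh, x). \<phi> xh x) \<in> borel_measurable (P \<Otimes>\<^sub>M P) \<and>
     (\<forall>xh\<in>space P. \<forall>x\<in>space P. \<phi> xh x \<noteq> \<infinity>) \<and>
     (\<forall>xh\<in>space P. \<forall>x\<in>space P. \<phi> xh x \<le> \<phi> x x)"

definition diag_dominant_set :: "'a measure \<Rightarrow> ('a \<times> 'a) set \<Rightarrow> bool" where
  "diag_dominant_set P A \<longleftrightarrow>
     A \<in> sets (P \<Otimes>\<^sub>M P) \<and> (\<forall>xh x. (xh, x) \<in> A \<longrightarrow> (x, x) \<in> A)"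

definition graph_of :: "'a measure \<Rightarrow> ('a \<Rightarrow> 'a set) \<Rightarrow> ('a \<times> 'a) set" where
  "graph_of P E = {(xh, x). xh \<in> space P \<and> x \<in> space P \<and> x \<in> E xh}"

definition diag_dominant_setfun :: "'a measure \<Rightarrow> ('a \<Rightarrow> 'a set) \<Rightarrow> bool" where
  "diag_dominant_setfun P E \<longleftrightarrow>
     (\<forall>xh\<in>space P. E xh \<in> sets P - {{}}) \<and>
     graph_of P E \<in> sets (P \<Otimes>\<^sub>M P) \<and>
     (\<forall>xh\<in>space P. \<forall>x\<in>space P. x \<in> E xh \<longrightarrow> x \<in> E x)"

definition measurable_projection :: "'a measure \<Rightarrow> bool" where
  "measurable_projection P \<longleftrightarrow>
     (\<forall>A. diag_dominant_set P A \<longrightarrow>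
        {xh \<in> space P. \<exists>x\<in>space P. (xh, x) \<in> A} \<in> sets (completion P))"

definition weak_measurable_selection :: "'a measure \<Rightarrow> bool" where
  "weak_measurable_selection P \<longleftrightarrow>
     (\<forall>E. diag_dominant_setfun P E \<longrightarrow>
        (\<exists>\<gamma>\<in>first_marginal_measures P. concentrated_on \<gamma> (graph_of P E)))"

end

theory Submission
  imports Defs
begin

text \<open>
  For the forward direction, apply (IP) to the indicator of \<open>A\<close> and to the function that is \<open>0\<close> on
  \<open>Graph(E)\<close> and \<open>-\<infinity>\<close> off it.  For the converse, let \<open>s\<close> be the pointwise supremum of \<open>\<phi>\<close>.  It is
  measurable because \<open>{s > c}\<close> is the projection of the diagonally dominant set \<open>{\<phi> > c}\<close>, and
  \<open>\<ge>\<close> in (IP) holds because \<open>\<phi>(xh, x) \<le> s(xh)\<close>.  For \<open>\<le>\<close>, the near-maximizers of \<open>\<phi>(xh, \<cdot>)\<close> do not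
  form a diagonally dominant set-valued function, but for a constant level \<open>c\<close> the set \<open>{\<phi> > c}\<close>
  extends to one.  So (Sel*) is applied once for each level of a countable grid, and the resulting
  measures are glued along the partition of the first coordinate by the grid level just below
  \<open>min s n\<close>; the grid has to be infinite since \<open>s\<close> may be unbounded below.
\<close>

section \<open>Extended reals: Borel versions, positive parts and truncation\<close>

text \<open>The positive and negative parts of \<open>f\<close> are \<open>ennreal\<close>-valued
  and each has a Borel version; the difference of these is a version of \<open>f\<close>. Almost
  everywhere one of the two is zero, so \<infinity> - \<infinity> does not arise there.\<close>

lemma completion_ex_borel_measurable_ereal:
  fixes f :: "'a \<Rightarrow> ereal"
  assumes f: "f \<in> borel_measurable (completion M)"
  shows "\<exists>g\<in>borel_measurable M. AE x in M. f x = g x"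
proof -
  have "(\<lambda>x. e2ennreal (f x)) \<in> borel_measurable (completion M)"
    "(\<lambda>x. e2ennreal (- f x)) \<in> borel_measurable (completion M)"
    using f by measurable
  from this[THEN completion_ex_borel_measurable]
  obtain p q :: "'a \<Rightarrow> ennreal" where pq[measurable]: "p \<in> borel_measurable M" "q \<in> borel_measurable M"
    and ae: "AE x in M. e2ennreal (f x) = p x" "AE x in M. e2ennreal (- f x) = q x"
    by auto
  have split: "enn2ereal (e2ennreal y) - enn2ereal (e2ennreal (- y)) = y" for y :: ereal
    by (cases "0 \<le> y") (auto simp: enn2ereal_e2ennreal e2ennreal_neg zero_ennreal.rep_eq)
  show ?thesis
  proof
    show "(\<lambda>x. enn2ereal (p x) - enn2ereal (q x)) \<in> borel_measurable M"
      by measurable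
    show "AE x in M. f x = enn2ereal (p x) - enn2ereal (q x)"
      using ae
    proof eventually_elim
      case (elim x)
      then show ?case using split[of "f x"] by simp
    qed
  qed
qed

text \<open>Taking the positive part is monotone and 1-Lipschitz. This turns pointwise
  near-optimality into inequalities between nonnegative integrands.\<close>

lemma e2ennreal_le_add:
  assumes "x \<le> y + ereal e" "0 \<le> e"
  shows "e2ennreal x \<le> e2ennreal y + ennreal e"
proof (cases "0 \<le> y")
  case True
  then have "e2ennreal (y + ereal e) = e2ennreal y + ennreal e"
    using assms(2)
    by (cases y) (auto simp: ennreal_plus[symmetric] simp del: ennreal_plus)
  then show ?thesis using e2ennreal_mono[OF assms(1)] by simp
next
  case False
  then have "x \<le> ereal e"
    using assms by (cases x; cases y) auto
  from e2ennreal_mono[OF this] show ?thesis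
    using False by (simp add: e2ennreal_neg)
qed

text \<open>A real \<open>x\<close> is reached as soon as \<open>n\<close> exceeds it; for
  \<open>x = \<infinity>\<close> the naturals are unbounded. Monotone convergence uses this to
  remove the truncation at \<open>n\<close>.\<close>

lemma SUP_e2ennreal_min: "(SUP n::nat. e2ennreal (min x (ereal (real n)))) = e2ennreal x"
proof (cases x)
  case (real r)
  obtain n :: nat where n: "r \<le> real n"
    using real_arch_simple by blast
  show ?thesis
  proof (rule antisym)
    show "(SUP n::nat. e2ennreal (min x (ereal (real n)))) \<le> e2ennreal x"
      by (intro SUP_least e2ennreal_mono) simp
    have "e2ennreal x = e2ennreal (min x (ereal (real n)))"
      using n real by (simp add: min_def)
    also have "\<dots> \<le> (SUP n::nat. e2ennreal (min x (ereal (real n))))"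
      by (intro SUP_upper) simp
    finally show "e2ennreal x \<le> (SUP n::nat. e2ennreal (min x (ereal (real n))))" .
  qed
next
  case PInf
  then show ?thesis
    by (simp add: ennreal_SUP_of_nat_eq_top flip: ennreal_of_nat_eq_real_of_nat)
next
  case MInf
  then show ?thesis by (simp add: e2ennreal_neg)
qed

section \<open>Measures with prescribed first marginal\<close>

lemma first_marginal_measuresD:
  assumes "\<gamma> \<in> first_marginal_measures P"
  shows "prob_space \<gamma>" "sets \<gamma> = sets (P \<Otimes>\<^sub>M P)" "space \<gamma> = space P \<times> space P"
    "distr \<gamma> P fst = P" "fst \<in> measurable \<gamma> P"
proof -
  show "prob_space \<gamma>" and s: "sets \<gamma> = sets (P \<Otimes>\<^sub>M P)" and "distr \<gamma> P fst = P"
    using assms by (auto simp: first_marginal_measures_def)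
  show "space \<gamma> = space P \<times> space P"
    using sets_eq_imp_space_eq[OF s] by (simp add: space_pair_measure)
  show "fst \<in> measurable \<gamma> P"
    using measurable_fst[of P P] measurable_cong_sets[OF s refl] by blast
qed

lemma AE_first_marginal:
  assumes "\<gamma> \<in> first_marginal_measures P" "AE x in P. Q x"
  shows "AE z in \<gamma>. Q (fst z)"
proof (rule AE_distrD[OF first_marginal_measuresD(5)[OF assms(1)]])
  show "AE x in distr \<gamma> P fst. Q x"
    unfolding first_marginal_measuresD(4)[OF assms(1)] by (rule assms(2))
qed

lemma nn_integral_first_marginal:
  assumes "\<gamma> \<in> first_marginal_measures P" and [measurable]: "f \<in> borel_measurable P"
  shows "(\<integral>\<^sup>+ z. f (fst z) \<partial>\<gamma>) = (\<integral>\<^sup>+ x. f x \<partial>P)"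
  using nn_integral_distr[of fst \<gamma> P f] first_marginal_measuresD[OF assms(1)] by simp

text \<open>The glued measure sends \<open>A\<close> to the sum over \<open>j\<close> of
  \<open>emeasure (\<gamma> j) (A \<inter> B j)\<close>, where \<open>B j\<close> is the strip over
  \<open>{idx = j}\<close>. On that strip its first marginal is that of \<open>\<gamma> j\<close>,
  hence \<open>P\<close>, and whether \<open>Q\<close> holds there is decided by
  \<open>\<gamma> j\<close> alone.\<close>

lemma first_marginal_glue:
  fixes idx :: "'a \<Rightarrow> nat"
  assumes P: "prob_space P"
    and idx[measurable]: "idx \<in> measurable P (count_space UNIV)"
    and \<gamma>: "\<And>j. \<gamma> j \<in> first_marginal_measures P"
    and Q[measurable]: "Measurable.pred (P \<Otimes>\<^sub>M P) Q"
    and ae: "\<And>j. AE z in \<gamma> j. idx (fst z) = j \<longrightarrow> Q z"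
  shows "\<exists>\<mu>\<in>first_marginal_measures P. AE z in \<mu>. Q z"
proof -
  define B where "B j = {z \<in> space (P \<Otimes>\<^sub>M P). idx (fst z) = j}" for j
  have B[measurable]: "B j \<in> sets (P \<Otimes>\<^sub>M P)" for j
    unfolding B_def by measurable
  note [simp] = first_marginal_measuresD(2)[OF \<gamma>]
  define m where "m A = (\<Sum>j. emeasure (\<gamma> j) (A \<inter> B j))" for A
  define \<mu> where "\<mu> = measure_of (space (P \<Otimes>\<^sub>M P)) (sets (P \<Otimes>\<^sub>M P)) m"
  have sets_\<mu>[simp]: "sets \<mu> = sets (P \<Otimes>\<^sub>M P)"
    by (simp add: \<mu>_def)
  then have space_\<mu>: "space \<mu> = space (P \<Otimes>\<^sub>M P)"
    by (rule sets_eq_imp_space_eq)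
  have ca: "countably_additive (sets (P \<Otimes>\<^sub>M P)) m"
  proof (rule countably_additiveI)
    fix A :: "nat \<Rightarrow> ('a \<times> 'a) set"
    assume A: "range A \<subseteq> sets (P \<Otimes>\<^sub>M P)" "disjoint_family A"
    then have [measurable]: "A i \<in> sets (P \<Otimes>\<^sub>M P)" for i by auto
    \<comment> \<open>The sum over \<open>i\<close> becomes an integral for counting measure, so
      that it can be interchanged with the sum over \<open>j\<close>.\<close>
    have "(\<Sum>i. m (A i)) = (\<integral>\<^sup>+i. (\<Sum>j. emeasure (\<gamma> j) (A i \<inter> B j)) \<partial>count_space UNIV)"
      by (simp add: nn_integral_count_space_nat m_def)
    also have "\<dots> = (\<Sum>j. \<integral>\<^sup>+i. emeasure (\<gamma> j) (A i \<inter> B j) \<partial>count_space UNIV)"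
      by (intro nn_integral_suminf) auto
    also have "\<dots> = (\<Sum>j. \<Sum>i. emeasure (\<gamma> j) (A i \<inter> B j))"
      by (simp add: nn_integral_count_space_nat)
    also have "\<dots> = (\<Sum>j. emeasure (\<gamma> j) (\<Union>i. A i \<inter> B j))"
      using A(2) by (intro suminf_cong suminf_emeasure) (auto simp: disjoint_family_on_def)
    finally show "(\<Sum>i. m (A i)) = m (\<Union> (range A))"
      by (simp add: m_def)
  qed
  have em: "emeasure \<mu> A = (\<Sum>j. emeasure (\<gamma> j) (A \<inter> B j))" if "A \<in> sets (P \<Otimes>\<^sub>M P)" for A
    unfolding \<mu>_def
    by (subst emeasure_measure_of_sigma[OF sets.sigma_algebra_axioms _ ca that])
       (auto simp: positive_def m_def)
  have marg: "emeasure \<mu> (fst -` S \<inter> space \<mu>) = emeasure P S" if [measurable]: "S \<in> sets P" for S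
  proof -
    define T where "T j = {x \<in> S. idx x = j}" for j
    have "{x \<in> space P. x \<in> S \<and> idx x = j} \<in> sets P" for j
      by measurable
    moreover have "{x \<in> space P. x \<in> S \<and> idx x = j} = T j" for j
      using sets.sets_into_space[OF that] by (auto simp: T_def)
    ultimately have T[measurable]: "T j \<in> sets P" for j by simp
    have "emeasure \<mu> (fst -` S \<inter> space \<mu>) = (\<Sum>j. emeasure (\<gamma> j) ((fst -` S \<inter> space \<mu>) \<inter> B j))"
      unfolding space_\<mu> by (intro em measurable_sets[OF measurable_fst]) simp
    also have "\<dots> = (\<Sum>j. emeasure (distr (\<gamma> j) P fst) (T j))"
    proof (intro suminf_cong)
      fix j
      \<comment> \<open>Inside the strip the cylinder over \<open>S\<close> is the cylinder over
        \<open>T j\<close>, whose \<open>\<gamma> j\<close>-measure is fixed by the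
        marginal.\<close>
      have "(fst -` S \<inter> space \<mu>) \<inter> B j = fst -` T j \<inter> space (\<gamma> j)"
        using first_marginal_measuresD(3)[OF \<gamma>, of j]
        by (auto simp: space_\<mu> space_pair_measure B_def T_def)
      then show "emeasure (\<gamma> j) ((fst -` S \<inter> space \<mu>) \<inter> B j) = emeasure (distr (\<gamma> j) P fst) (T j)"
        using first_marginal_measuresD(5)[OF \<gamma>, of j] by (simp add: emeasure_distr)
    qed
    also have "\<dots> = (\<Sum>j. emeasure P (T j))"
      by (simp add: first_marginal_measuresD(4)[OF \<gamma>])
    also have "\<dots> = emeasure P (\<Union>j. T j)"
      by (intro suminf_emeasure) (auto simp: disjoint_family_on_def T_def)
    also have "(\<Union>j. T j) = S" by (auto simp: T_def)
    finally show ?thesis .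
  qed
  have fst_\<mu>: "fst \<in> measurable \<mu> P"
    using measurable_fst[of P P] measurable_cong_sets[OF sets_\<mu> refl] by blast
  have "fst -` space P \<inter> space \<mu> = space \<mu>"
    by (auto simp: space_\<mu> space_pair_measure)
  then have "emeasure \<mu> (space \<mu>) = 1"
    using marg[of "space P"] prob_space.emeasure_space_1[OF P] by simp
  then have "prob_space \<mu>" by (rule prob_spaceI)
  moreover have "distr \<mu> P fst = P"
    by (rule measure_eqI) (auto simp: emeasure_distr fst_\<mu> marg)
  ultimately have "\<mu> \<in> first_marginal_measures P"
    by (simp add: first_marginal_measures_def)
  moreover have "AE z in \<mu>. Q z"
  proof (rule AE_I)
    let ?N = "{z \<in> space (P \<Otimes>\<^sub>M P). \<not> Q z}"
    show "{z \<in> space \<mu>. \<not> Q z} \<subseteq> ?N" by (simp add: space_\<mu>)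
    have [measurable]: "?N \<in> sets (P \<Otimes>\<^sub>M P)" by measurable
    then show "?N \<in> sets \<mu>" by simp
    \<comment> \<open>By \<open>em\<close>, \<open>\<gamma> j\<close> contributes just the part of
      the exceptional set inside \<open>B j\<close>, where the premise
      \<open>idx (fst z) = j\<close> of \<open>ae\<close> holds.\<close>
    have "emeasure (\<gamma> j) (?N \<inter> B j) = 0" for j
    proof -
      have "AE z in \<gamma> j. z \<notin> ?N \<inter> B j"
        using ae[of j] by eventually_elim (auto simp: B_def)
      then show ?thesis
        by (subst (asm) AE_iff_measurable[of "?N \<inter> B j"])
           (auto simp: B_def first_marginal_measuresD(3)[OF \<gamma>] space_pair_measure)
    qed
    then show "emeasure \<mu> ?N = 0" by (simp add: em)
  qed
  ultimately show ?thesis by blast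
qed

section \<open>Selection above one level, then above countably many\<close>

text \<open>For a constant \<open>c\<close>, \<open>c < \<phi> xh x\<close> implies
  \<open>c < \<phi> x x\<close>, so the sections of \<open>{\<phi> > c}\<close> are compatible with
  diagonal dominance. They are nonempty over \<open>F\<close>; values off \<open>F\<close> are
  filled in so that weak selection applies, and the conclusion ignores them.\<close>

lemma weak_selection_level:
  assumes sel: "weak_measurable_selection P" and \<phi>: "diag_dominant_fun P \<phi>"
    and F[measurable]: "F \<in> sets P"
    and ex: "\<And>xh. xh \<in> F \<Longrightarrow> \<exists>x\<in>space P. c < \<phi> xh x"
  shows "\<exists>\<gamma>\<in>first_marginal_measures P. AE z in \<gamma>. fst z \<in> F \<longrightarrow> c < \<phi> (fst z) (snd z)"
proof -
  have [measurable]: "(\<lambda>(xh, x). \<phi> xh x) \<in> borel_measurable (P \<Otimes>\<^sub>M P)"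
    and dd: "\<And>xh x. xh \<in> space P \<Longrightarrow> x \<in> space P \<Longrightarrow> \<phi> xh x \<le> \<phi> x x"
    using \<phi> by (auto simp: diag_dominant_fun_def)
  note FP = sets.sets_into_space[OF F]
  \<comment> \<open>Off \<open>F\<close> the singleton \<open>{xh}\<close> would be the natural value, but the diagonal need not be
    measurable; the set of all \<open>x\<close> with \<open>x \<in> E x\<close> is used instead.\<close>
  define E where "E xh = {x \<in> space P. if xh \<in> F then c < \<phi> xh x else x \<notin> F \<or> c < \<phi> x x}" for xh
  have "diag_dominant_setfun P E"
    unfolding diag_dominant_setfun_def
  proof (intro conjI ballI impI)
    fix xh assume xh[measurable]: "xh \<in> space P"
    have "E xh \<in> sets P"
      unfolding E_def by measurable
    \<comment> \<open>Off \<open>F\<close>, the point \<open>xh\<close> itself lies in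
      \<open>E xh\<close>.\<close>
    moreover have "E xh \<noteq> {}"
      using ex[of xh] xh by (auto simp: E_def)
    ultimately show "E xh \<in> sets P - {{}}" by simp
  next
    have "{z \<in> space (P \<Otimes>\<^sub>M P). if fst z \<in> F then c < \<phi> (fst z) (snd z)
        else snd z \<notin> F \<or> c < \<phi> (snd z) (snd z)} \<in> sets (P \<Otimes>\<^sub>M P)"
      by measurable
    also have "{z \<in> space (P \<Otimes>\<^sub>M P). if fst z \<in> F then c < \<phi> (fst z) (snd z)
        else snd z \<notin> F \<or> c < \<phi> (snd z) (snd z)} = graph_of P E"
      by (auto simp: graph_of_def E_def space_pair_measure split: if_splits)
    finally show "graph_of P E \<in> sets (P \<Otimes>\<^sub>M P)" .
  next
    \<comment> \<open>If \<open>xh \<in> F\<close>, then \<open>c < \<phi> x x\<close>, which gives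
      \<open>x \<in> E x\<close> whether or not \<open>x \<in> F\<close>. If
      \<open>xh \<notin> F\<close>, the condition defining \<open>E xh\<close> is already equivalent
      to \<open>x \<in> E x\<close>.\<close>
    fix xh x assume "xh \<in> space P" "x \<in> space P" "x \<in> E xh"
    then show "x \<in> E x"
      using dd[of xh x] by (auto simp: E_def split: if_splits)
  qed
  then obtain \<gamma> where \<gamma>: "\<gamma> \<in> first_marginal_measures P" "concentrated_on \<gamma> (graph_of P E)"
    and gr: "graph_of P E \<in> sets (P \<Otimes>\<^sub>M P)"
    using sel unfolding weak_measurable_selection_def diag_dominant_setfun_def by blast
  interpret \<gamma>: prob_space \<gamma> by (rule first_marginal_measuresD[OF \<gamma>(1)])
  have "graph_of P E \<subseteq> space \<gamma>"
    by (auto simp: first_marginal_measuresD(3)[OF \<gamma>(1)] graph_of_def)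
  then have "{z \<in> space \<gamma>. z \<in> graph_of P E} = graph_of P E" by auto
  then have "AE z in \<gamma>. z \<in> graph_of P E"
    using \<gamma>(2) gr first_marginal_measuresD(2)[OF \<gamma>(1)]
    by (intro \<gamma>.AE_I_eq_1) (auto simp: concentrated_on_def)
  then have "AE z in \<gamma>. fst z \<in> F \<longrightarrow> c < \<phi> (fst z) (snd z)"
    by eventually_elim (auto simp: graph_of_def E_def)
  with \<gamma>(1) show ?thesis by blast
qed

text \<open>Strict superlevel sets are the right generators: a supremum exceeds \<open>y\<close>
  exactly when some value does, even if it is not attained, so \<open>{s > y}\<close> is exactly a
  projection.\<close>

lemma diag_dominant_SUP_measurable:
  assumes proj: "measurable_projection P" and \<phi>: "diag_dominant_fun P \<phi>"
  shows "(\<lambda>xh. SUP x\<in>space P. \<phi> xh x) \<in> borel_measurable (completion P)"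
proof (rule borel_measurableI_greater)
  fix y :: ereal
  let ?A = "{z \<in> space (P \<Otimes>\<^sub>M P). y < \<phi> (fst z) (snd z)}"
  have [measurable]: "(\<lambda>(xh, x). \<phi> xh x) \<in> borel_measurable (P \<Otimes>\<^sub>M P)"
    and dd: "\<And>xh x. xh \<in> space P \<Longrightarrow> x \<in> space P \<Longrightarrow> \<phi> xh x \<le> \<phi> x x"
    using \<phi> by (auto simp: diag_dominant_fun_def)
  have "?A \<in> sets (P \<Otimes>\<^sub>M P)" by measurable
  then have "diag_dominant_set P ?A"
    using dd by (auto simp: diag_dominant_set_def space_pair_measure intro: less_le_trans)
  then have "{xh \<in> space P. \<exists>x\<in>space P. (xh, x) \<in> ?A} \<in> sets (completion P)"
    using proj unfolding measurable_projection_def by blast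
  also have "{xh \<in> space P. \<exists>x\<in>space P. (xh, x) \<in> ?A} =
      {xh \<in> space (completion P). y < (SUP x\<in>space P. \<phi> xh x)}"
    by (auto simp: less_SUP_iff space_pair_measure)
  finally show "{xh \<in> space (completion P). y < (SUP x\<in>space P. \<phi> xh x)} \<in> sets (completion P)" .
qed

text \<open>For each \<open>j\<close>, a measure is selected above level \<open>c j\<close> wherever
  the supremum exceeds \<open>c j\<close>; almost every point with \<open>idx xh = j\<close> is of
  this kind, so gluing along \<open>idx\<close> yields the claim.\<close>

lemma weak_selection_countable_levels:
  fixes idx :: "'a \<Rightarrow> nat" and c :: "nat \<Rightarrow> ereal"
  assumes P: "prob_space P" and proj: "measurable_projection P"
    and sel: "weak_measurable_selection P" and \<phi>: "diag_dominant_fun P \<phi>"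
    and idx[measurable]: "idx \<in> measurable P (count_space UNIV)"
    and less: "AE xh in P. c (idx xh) < (SUP x\<in>space P. \<phi> xh x)"
  shows "\<exists>\<gamma>\<in>first_marginal_measures P. AE z in \<gamma>. c (idx (fst z)) < \<phi> (fst z) (snd z)"
proof -
  have [measurable]: "(\<lambda>(xh, x). \<phi> xh x) \<in> borel_measurable (P \<Otimes>\<^sub>M P)"
    using \<phi> by (auto simp: diag_dominant_fun_def)
  define G where "G j = {xh \<in> space (completion P). c j < (SUP x\<in>space P. \<phi> xh x)}" for j
  have G: "G j \<in> sets (completion P)" for j
    unfolding G_def using diag_dominant_SUP_measurable[OF proj \<phi>] by measurable
  \<comment> \<open>\<open>G j\<close> lies in the completion only, while selection at a level takes
    a set of \<open>P\<close>. The main part is such a set: it is contained in \<open>G j\<close>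
    and differs from it by a null set.\<close>
  define F where "F j = main_part P (G j)" for j
  have F: "F j \<in> sets P" "F j \<subseteq> G j" for j
    using main_part_sets[OF G[of j]] main_part_null_part_Un[OF G[of j]] unfolding F_def by blast+
  have "\<exists>\<gamma>\<in>first_marginal_measures P. AE z in \<gamma>. fst z \<in> F j \<longrightarrow> c j < \<phi> (fst z) (snd z)" for j
    using F(2)[of j] by (intro weak_selection_level[OF sel \<phi> F(1)]) (auto simp: G_def less_SUP_iff)
  then obtain \<gamma> where \<gamma>: "\<And>j. \<gamma> j \<in> first_marginal_measures P"
    and lv: "\<And>j. AE z in \<gamma> j. fst z \<in> F j \<longrightarrow> c j < \<phi> (fst z) (snd z)"
    by metis
  show ?thesis
  proof (rule first_marginal_glue[OF P idx \<gamma>])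
    show "Measurable.pred (P \<Otimes>\<^sub>M P) (\<lambda>z. c (idx (fst z)) < \<phi> (fst z) (snd z))"
      by measurable
    fix j
    have "AE xh in P. idx xh = j \<longrightarrow> xh \<in> F j"
      using less AE_in_main_part[OF G[of j]] AE_space
      by eventually_elim (auto simp: F_def G_def)
    from AE_first_marginal[OF \<gamma>[of j] this] lv[of j]
    show "AE z in \<gamma> j. idx (fst z) = j \<longrightarrow> c (idx (fst z)) < \<phi> (fst z) (snd z)"
      by eventually_elim auto
  qed
qed

text \<open>The levels are the integer multiples of \<open>e\<close>. Since
  \<open>min (s xh) n\<close> is real almost everywhere, there is a multiple strictly below it and
  at distance at most \<open>e\<close>; a measure selecting above that multiple is within
  \<open>e\<close> of the truncated supremum.\<close>

lemma weak_selection_near_truncated_SUP: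
  fixes e :: real
  assumes P: "prob_space P" and proj: "measurable_projection P"
    and sel: "weak_measurable_selection P" and \<phi>: "diag_dominant_fun P \<phi>"
    and s[measurable]: "s \<in> borel_measurable P"
    and s_eq: "AE xh in P. (SUP x\<in>space P. \<phi> xh x) = s xh"
    and s_gt: "AE xh in P. s xh > -\<infinity>" and e: "0 < e"
  shows "\<exists>\<gamma>\<in>first_marginal_measures P.
    AE z in \<gamma>. min (s (fst z)) (ereal (real n)) \<le> \<phi> (fst z) (snd z) + ereal e"
proof -
  define r where "r xh = real_of_ereal (min (s xh) (ereal (real n)))" for xh
  \<comment> \<open>Ceiling minus one, rather than floor, keeps the level strictly below
    \<open>r xh\<close> even when \<open>r xh\<close> is a multiple of \<open>e\<close>; a supremum
    that is not attained has values above strictly smaller levels only.\<close>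
  define k :: "'a \<Rightarrow> int" where "k xh = \<lceil>r xh / e\<rceil> - 1" for xh
  \<comment> \<open>All integers are enumerated by naturals, to match the index type of the
    gluing.\<close>
  define c where "c j = ereal (real_of_int (from_nat j) * e)" for j :: nat
  have k: "real_of_int (k xh) * e < r xh" "r xh \<le> real_of_int (k xh) * e + e" for xh
  proof -
    have "real_of_int (k xh) < r xh / e" "r xh / e \<le> real_of_int (k xh) + 1"
      unfolding k_def by linarith+
    then show "real_of_int (k xh) * e < r xh" "r xh \<le> real_of_int (k xh) * e + e"
      using e by (simp_all add: field_simps)
  qed
  \<comment> \<open>Where \<open>s xh = -\<infinity>\<close>, \<open>real_of_ereal\<close> returns
    the default 0; by \<open>s_gt\<close> this concerns a null set.\<close>
  have r: "ereal (r xh) = min (s xh) (ereal (real n))" if "s xh > -\<infinity>" for xh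
    using that by (cases "s xh") (auto simp: r_def min_def)
  have [measurable]: "r \<in> borel_measurable P"
    unfolding r_def by measurable
  have [measurable]: "k \<in> measurable P (count_space UNIV)"
    unfolding k_def by measurable
  have idx: "(\<lambda>xh. to_nat (k xh)) \<in> measurable P (count_space UNIV)"
    by measurable
  have "AE xh in P. c (to_nat (k xh)) < (SUP x\<in>space P. \<phi> xh x)"
    using s_eq s_gt
  proof eventually_elim
    case (elim xh)
    have "c (to_nat (k xh)) < ereal (r xh)" using k[of xh] by (simp add: c_def)
    also have "\<dots> \<le> s xh" using r elim by simp
    finally show ?case using elim by simp
  qed
  from weak_selection_countable_levels[OF P proj sel \<phi> idx this]
  obtain \<gamma> where \<gamma>: "\<gamma> \<in> first_marginal_measures P"
    and lt: "AE z in \<gamma>. c (to_nat (k (fst z))) < \<phi> (fst z) (snd z)" by auto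
  have "AE z in \<gamma>. min (s (fst z)) (ereal (real n)) \<le> \<phi> (fst z) (snd z) + ereal e"
    using lt AE_first_marginal[OF \<gamma> s_gt]
  proof eventually_elim
    case (elim z)
    have "min (s (fst z)) (ereal (real n)) \<le> c (to_nat (k (fst z))) + ereal e"
      using k(2)[of "fst z"] r[OF elim(2), symmetric] by (simp add: c_def)
    also have "\<dots> \<le> \<phi> (fst z) (snd z) + ereal e"
      using elim(1) by (intro add_right_mono) simp
    finally show ?case .
  qed
  with \<gamma> show ?thesis by blast
qed

section \<open>From projection and selection to interchangeability\<close>

text \<open>Let \<open>p\<close> and \<open>q\<close> be the integrals of the positive and negative
  parts of the supremum. The lower bound first shows, for finite \<open>q\<close>, that the positive
  part of \<open>min s n\<close> integrates to at most \<open>V + q\<close>; then \<open>n\<close>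
  tends to infinity, and \<open>q\<close> is subtracted last.\<close>

lemma interchangeable_if_projection_selection:
  assumes P: "prob_space P" and proj: "measurable_projection P"
    and sel: "weak_measurable_selection P" and \<phi>: "diag_dominant_fun P \<phi>"
  shows "interchangeable P \<phi>"
proof -
  have \<phi>_meas[measurable]: "(\<lambda>(xh, x). \<phi> xh x) \<in> borel_measurable (P \<Otimes>\<^sub>M P)"
    using \<phi> by (auto simp: diag_dominant_fun_def)
  let ?S = "\<lambda>xh. SUP x\<in>space P. \<phi> xh x"
  let ?\<phi> = "\<lambda>(xh, x). \<phi> xh x"
  note S_meas = diag_dominant_SUP_measurable[OF proj \<phi>]
  \<comment> \<open>A Borel version is needed because the marginal of each \<gamma> is
    \<open>P\<close>, not its completion.\<close>
  obtain s where s[measurable]: "s \<in> borel_measurable P" and s_eq: "AE xh in P. ?S xh = s xh"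
    using completion_ex_borel_measurable_ereal[OF S_meas] by blast
  define p where "p = (\<integral>\<^sup>+ x. e2ennreal (s x) \<partial>P)"
  define q where "q = (\<integral>\<^sup>+ x. e2ennreal (- s x) \<partial>P)"
  define V where "V = (SUP \<gamma>\<in>{\<gamma> \<in> first_marginal_measures P. integral_well_defined \<gamma> ?\<phi>}.
           ereal_expectation \<gamma> ?\<phi>)"
  have p_eq: "(\<integral>\<^sup>+ x. e2ennreal (?S x) \<partial>completion P) = p"
    unfolding p_def nn_integral_completion using s_eq by (intro nn_integral_cong_AE) auto
  have q_eq: "(\<integral>\<^sup>+ x. e2ennreal (- ?S x) \<partial>completion P) = q"
    unfolding q_def nn_integral_completion using s_eq by (intro nn_integral_cong_AE) auto
  have ES: "ereal_expectation (completion P) ?S = enn2ereal p - enn2ereal q"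
    unfolding ereal_expectation_def p_eq q_eq ..
  have upper: "V \<le> enn2ereal p - enn2ereal q"
    unfolding V_def
  proof (intro SUP_least, safe)
    fix \<gamma> assume \<gamma>: "\<gamma> \<in> first_marginal_measures P"
    have le: "AE z in \<gamma>. ?\<phi> z \<le> s (fst z)"
      using AE_first_marginal[OF \<gamma> s_eq] AE_space
    proof eventually_elim
      case (elim z)
      have "?\<phi> z \<le> ?S (fst z)"
        using elim(2) by (auto simp: first_marginal_measuresD(3)[OF \<gamma>] intro!: SUP_upper)
      with elim show ?case by simp
    qed
    have "(\<integral>\<^sup>+ z. e2ennreal (?\<phi> z) \<partial>\<gamma>) \<le> (\<integral>\<^sup>+ z. e2ennreal (s (fst z)) \<partial>\<gamma>)"
      using le by (intro nn_integral_mono_AE) (auto intro: e2ennreal_mono)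
    also have "\<dots> = p"
      unfolding p_def by (rule nn_integral_first_marginal[OF \<gamma>]) measurable
    finally have a: "(\<integral>\<^sup>+ z. e2ennreal (?\<phi> z) \<partial>\<gamma>) \<le> p" .
    have "q = (\<integral>\<^sup>+ z. e2ennreal (- s (fst z)) \<partial>\<gamma>)"
      unfolding q_def by (rule nn_integral_first_marginal[OF \<gamma>, symmetric]) measurable
    also have "\<dots> \<le> (\<integral>\<^sup>+ z. e2ennreal (- ?\<phi> z) \<partial>\<gamma>)"
    proof (rule nn_integral_mono_AE)
      show "AE z in \<gamma>. e2ennreal (- s (fst z)) \<le> e2ennreal (- ?\<phi> z)"
        using le by eventually_elim (simp add: e2ennreal_mono)
    qed
    finally have b: "q \<le> (\<integral>\<^sup>+ z. e2ennreal (- ?\<phi> z) \<partial>\<gamma>)" .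
    show "ereal_expectation \<gamma> ?\<phi> \<le> enn2ereal p - enn2ereal q"
      unfolding ereal_expectation_def
      by (intro ereal_minus_mono) (use a b in \<open>simp_all add: less_eq_ennreal.rep_eq\<close>)
  qed
  \<comment> \<open>\<open>wd\<close> excludes \<open>p = q = \<infinity>\<close>, where subtraction
    in \<open>ereal\<close> returns \<infinity> by convention.\<close>
  have lower: "enn2ereal p - enn2ereal q \<le> V" if wd: "p < \<infinity> \<or> q < \<infinity>"
  proof (cases "q < \<infinity>")
    case False
    \<comment> \<open>In this case the left-hand side is -\<infinity>.\<close>
    then have "q = top" "p < top" using wd by (auto simp: not_less top_unique)
    then show ?thesis by (cases p) (auto simp: top_ennreal.rep_eq top_ereal_def)
  next
    case True
    then obtain i where i: "q = ennreal i" "0 \<le> i" by (cases q) auto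
    have "AE x in P. e2ennreal (- s x) \<noteq> \<infinity>"
      using True by (intro nn_integral_noteq_infinite) (auto simp: q_def)
    then have s_gt: "AE x in P. s x > -\<infinity>"
      by eventually_elim auto
    define c where "c n = (\<integral>\<^sup>+ x. e2ennreal (min (s x) (ereal (real n))) \<partial>P)" for n
    have c_le: "enn2ereal (c n) \<le> V + ereal i" for n
    proof (rule ereal_le_epsilon2)
      fix d :: real assume d: "0 < d"
      \<comment> \<open>The error \<open>e\<close> is paid twice, once for the positive part in
        \<open>ca\<close> and once for the negative part in \<open>bq\<close>.\<close>
      define e where "e = d / 2"
      have e: "0 < e" using d by (simp add: e_def)
      obtain \<gamma> where \<gamma>: "\<gamma> \<in> first_marginal_measures P"
        and near: "AE z in \<gamma>. min (s (fst z)) (ereal (real n)) \<le> \<phi> (fst z) (snd z) + ereal e"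
        using weak_selection_near_truncated_SUP[OF P proj sel \<phi> s s_eq s_gt e] by blast
      interpret \<gamma>: prob_space \<gamma> by (rule first_marginal_measuresD[OF \<gamma>])
      have [measurable_cong]: "sets \<gamma> = sets (P \<Otimes>\<^sub>M P)"
        by (rule first_marginal_measuresD[OF \<gamma>])
      define a where "a = (\<integral>\<^sup>+ z. e2ennreal (?\<phi> z) \<partial>\<gamma>)"
      define b where "b = (\<integral>\<^sup>+ z. e2ennreal (- ?\<phi> z) \<partial>\<gamma>)"
      have "c n = (\<integral>\<^sup>+ z. e2ennreal (min (s (fst z)) (ereal (real n))) \<partial>\<gamma>)"
        unfolding c_def by (rule nn_integral_first_marginal[OF \<gamma>, symmetric]) measurable
      also have "\<dots> \<le> (\<integral>\<^sup>+ z. e2ennreal (?\<phi> z) + ennreal e \<partial>\<gamma>)"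
      proof (rule nn_integral_mono_AE)
        show "AE z in \<gamma>. e2ennreal (min (s (fst z)) (ereal (real n))) \<le> e2ennreal (?\<phi> z) + ennreal e"
          using near
        proof eventually_elim
          case (elim z)
          then show ?case
            using e2ennreal_le_add[OF elim] e by (simp add: case_prod_beta)
        qed
      qed
      also have "\<dots> = a + ennreal e"
        unfolding a_def by (subst nn_integral_add) (auto simp: \<gamma>.emeasure_space_1)
      finally have ca: "c n \<le> a + ennreal e" .
      \<comment> \<open>Bounding the negative part by \<open>q + e\<close> makes the expectation of
        \<phi> under \<gamma> well defined, so that \<gamma> competes in the supremum
        \<open>V\<close>.\<close>
      have "b \<le> (\<integral>\<^sup>+ z. e2ennreal (- s (fst z)) + ennreal e \<partial>\<gamma>)"
        unfolding b_def
      proof (rule nn_integral_mono_AE)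
        show "AE z in \<gamma>. e2ennreal (- ?\<phi> z) \<le> e2ennreal (- s (fst z)) + ennreal e"
          using near
        proof eventually_elim
          case (elim z)
          have "- ?\<phi> z \<le> - min (s (fst z)) (ereal (real n)) + ereal e"
            using elim e unfolding case_prod_beta
            by (cases "\<phi> (fst z) (snd z)"; cases "s (fst z)") (auto simp: min_def split: if_splits)
          then have "e2ennreal (- ?\<phi> z) \<le> e2ennreal (- min (s (fst z)) (ereal (real n))) + ennreal e"
            using e by (intro e2ennreal_le_add) auto
          \<comment> \<open>Truncation at \<open>n \<ge> 0\<close> changes \<open>s\<close> only
            where it is positive, so the negative part is untouched.\<close>
          also have "e2ennreal (- min (s (fst z)) (ereal (real n))) = e2ennreal (- s (fst z))"
            by (cases "s (fst z)") (auto simp: min_def ennreal_neg e2ennreal_neg)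
          finally show ?case .
        qed
      qed
      also have "\<dots> = (\<integral>\<^sup>+ z. e2ennreal (- s (fst z)) \<partial>\<gamma>) + ennreal e"
        by (subst nn_integral_add) (auto simp: \<gamma>.emeasure_space_1)
      also have "(\<integral>\<^sup>+ z. e2ennreal (- s (fst z)) \<partial>\<gamma>) = q"
        unfolding q_def by (rule nn_integral_first_marginal[OF \<gamma>]) measurable
      also have "q + ennreal e = ennreal (i + e)"
        using i e by simp
      finally have bq: "b \<le> ennreal (i + e)" .
      then have b_fin: "b < \<infinity>"
        using le_less_trans ennreal_less_top infinity_ennreal_def by metis
      then obtain b' where b': "b = ennreal b'" "0 \<le> b'" by (cases b) auto
      have b'_le: "b' \<le> i + e"
        using bq b' i e by (simp del: ennreal_plus)
      have "enn2ereal a - enn2ereal b \<le> V"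
        unfolding V_def a_def b_def ereal_expectation_def[symmetric]
        using \<gamma> b_fin by (intro SUP_upper) (auto simp: integral_well_defined_def b_def)
      then have "enn2ereal a \<le> V + ereal b'"
        using b' by (cases "enn2ereal a"; cases V) auto
      also have "\<dots> \<le> V + ereal (i + e)"
        using b'_le by (intro add_left_mono) simp
      finally have "enn2ereal a + ereal e \<le> V + ereal (i + e) + ereal e"
        by (rule add_right_mono)
      moreover have "enn2ereal (c n) \<le> enn2ereal a + ereal e"
        using ca e by (simp add: less_eq_ennreal.rep_eq plus_ennreal.rep_eq)
      moreover have "V + ereal (i + e) + ereal e = V + ereal i + ereal d"
        by (cases V) (auto simp: e_def)
      ultimately show "enn2ereal (c n) \<le> V + ereal i + ereal d" by simp
    qed
    \<comment> \<open>Monotone convergence is applied to positive parts, which are nonnegative and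
      increase with \<open>n\<close>.\<close>
    have p_sup: "p = (SUP n. c n)"
    proof -
      have "p = (\<integral>\<^sup>+ x. (SUP n. e2ennreal (min (s x) (ereal (real n)))) \<partial>P)"
        unfolding p_def SUP_e2ennreal_min ..
      also have "\<dots> = (SUP n. c n)"
        unfolding c_def
        by (intro nn_integral_monotone_convergence_SUP)
           (auto simp: incseq_def le_fun_def intro!: e2ennreal_mono min.mono)
      finally show ?thesis .
    qed
    \<comment> \<open>Nonnegativity makes \<open>e2ennreal\<close> lossless at
      \<open>V + ereal i\<close>, so the bound on \<open>p\<close> can be read back in
      \<open>ereal\<close>.\<close>
    have nonneg: "0 \<le> V + ereal i"
      using c_le[of 0] order_trans[OF enn2ereal_nonneg] by blast
    have "p \<le> e2ennreal (V + ereal i)"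
      unfolding p_sup
    proof (rule SUP_least)
      fix n
      show "c n \<le> e2ennreal (V + ereal i)"
        using e2ennreal_mono[OF c_le[of n]] by simp
    qed
    then have "enn2ereal p \<le> V + ereal i"
      using nonneg by (simp add: less_eq_ennreal.rep_eq enn2ereal_e2ennreal)
    then show ?thesis
      using i by (cases "enn2ereal p"; cases V) auto
  qed
  show ?thesis
    unfolding interchangeable_def integral_well_defined_def p_eq q_eq ES
    using S_meas upper lower unfolding V_def integral_well_defined_def by (auto intro: antisym)
qed

section \<open>From interchangeability to projection and selection\<close>

text \<open>The indicator inherits diagonal dominance from \<open>A\<close>, and its supremum over
  the second coordinate is positive exactly on the projection. The measurability clause of
  interchangeability then gives the claim.\<close>

lemma measurable_projection_if_interchangeable:
  assumes ip: "\<And>\<phi>. diag_dominant_fun P \<phi> \<Longrightarrow> interchangeable P \<phi>"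
  shows "measurable_projection P"
  unfolding measurable_projection_def
proof (intro allI impI)
  fix A assume A: "diag_dominant_set P A"
  then have [measurable]: "A \<in> sets (P \<Otimes>\<^sub>M P)" by (simp add: diag_dominant_set_def)
  define \<phi> :: "'a \<Rightarrow> 'a \<Rightarrow> ereal" where "\<phi> xh x = indicator A (xh, x)" for xh x
  have "(\<lambda>(xh, x). \<phi> xh x) \<in> borel_measurable (P \<Otimes>\<^sub>M P)"
    unfolding \<phi>_def case_prod_eta by measurable
  then have "diag_dominant_fun P \<phi>"
    using A by (auto simp: diag_dominant_fun_def diag_dominant_set_def \<phi>_def split: split_indicator)
  from ip[OF this] have [measurable]: "(\<lambda>xh. SUP x\<in>space P. \<phi> xh x) \<in> borel_measurable (completion P)"
    by (simp add: interchangeable_def)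
  have "{xh \<in> space (completion P). 0 < (SUP x\<in>space P. \<phi> xh x)} \<in> sets (completion P)"
    by measurable
  also have "{xh \<in> space (completion P). 0 < (SUP x\<in>space P. \<phi> xh x)} =
      {xh \<in> space P. \<exists>x\<in>space P. (xh, x) \<in> A}"
    by (auto simp: less_SUP_iff \<phi>_def indicator_def)
  finally show "{xh \<in> space P. \<exists>x\<in>space P. (xh, x) \<in> A} \<in> sets (completion P)" .
qed

text \<open>With values 0 on the graph and -\<infinity> off it, nonempty sections make the pointwise
  supremum 0. Interchangeability then yields a measure with expectation above -\<infinity>, and such
  a measure cannot charge the complement of the graph.\<close>

lemma weak_measurable_selection_if_interchangeable:
  assumes ip: "\<And>\<phi>. diag_dominant_fun P \<phi> \<Longrightarrow> interchangeable P \<phi>"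
  shows "weak_measurable_selection P"
  unfolding weak_measurable_selection_def
proof (intro allI impI)
  fix E assume E: "diag_dominant_setfun P E"
  let ?G = "graph_of P E"
  have G[measurable]: "?G \<in> sets (P \<Otimes>\<^sub>M P)"
    using E by (simp add: diag_dominant_setfun_def)
  define \<phi> :: "'a \<Rightarrow> 'a \<Rightarrow> ereal" where "\<phi> xh x = (if (xh, x) \<in> ?G then 0 else -\<infinity>)" for xh x
  have "(\<lambda>z. if z \<in> ?G then 0 else -\<infinity> :: ereal) \<in> borel_measurable (P \<Otimes>\<^sub>M P)"
    by measurable
  also have "(\<lambda>z. if z \<in> ?G then 0 else -\<infinity> :: ereal) = (\<lambda>(xh, x). \<phi> xh x)"
    by (auto simp: \<phi>_def)
  finally have "diag_dominant_fun P \<phi>"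
    using E by (auto simp: diag_dominant_fun_def diag_dominant_setfun_def \<phi>_def graph_of_def)
  note ip = ip[OF this]
  have S: "(SUP x\<in>space P. \<phi> xh x) = 0" if xh: "xh \<in> space (completion P)" for xh
  proof -
    obtain x where x: "x \<in> E xh" "x \<in> space P"
      using E xh sets.sets_into_space[of "E xh" P]
      by (force simp: diag_dominant_setfun_def)
    then have "\<phi> xh x = 0" using xh by (simp add: \<phi>_def graph_of_def)
    then have "0 \<le> (SUP x\<in>space P. \<phi> xh x)" using x(2) by (metis SUP_upper)
    moreover have "(SUP x\<in>space P. \<phi> xh x) \<le> 0" by (intro SUP_least) (simp add: \<phi>_def)
    ultimately show ?thesis by simp
  qed
  have "(\<integral>\<^sup>+ x. e2ennreal (SUP y\<in>space P. \<phi> x y) \<partial>completion P) = (\<integral>\<^sup>+ x. 0 \<partial>completion P)"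
    "(\<integral>\<^sup>+ x. e2ennreal (- (SUP y\<in>space P. \<phi> x y)) \<partial>completion P) = (\<integral>\<^sup>+ x. 0 \<partial>completion P)"
    by (rule nn_integral_cong, simp add: S)+
  then have "integral_well_defined (completion P) (\<lambda>xh. SUP x\<in>space P. \<phi> xh x)"
    "ereal_expectation (completion P) (\<lambda>xh. SUP x\<in>space P. \<phi> xh x) = 0"
    by (simp_all add: integral_well_defined_def ereal_expectation_def zero_ennreal.rep_eq)
  \<comment> \<open>The supremum over \<gamma> equals 0; being above -\<infinity> already produces a
    suitable \<gamma>, without attainment.\<close>
  then have "-\<infinity> < (SUP \<gamma>\<in>{\<gamma> \<in> first_marginal_measures P. integral_well_defined \<gamma> (\<lambda>(xh, x). \<phi> xh x)}.
           ereal_expectation \<gamma> (\<lambda>(xh, x). \<phi> xh x))"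
    using ip unfolding interchangeable_def by auto
  then obtain \<gamma> where \<gamma>: "\<gamma> \<in> first_marginal_measures P"
    and gt: "-\<infinity> < ereal_expectation \<gamma> (\<lambda>(xh, x). \<phi> xh x)"
    unfolding less_SUP_iff by blast
  interpret \<gamma>: prob_space \<gamma> by (rule first_marginal_measuresD[OF \<gamma>])
  have sets_\<gamma>[measurable_cong]: "sets \<gamma> = sets (P \<Otimes>\<^sub>M P)"
    by (rule first_marginal_measuresD[OF \<gamma>])
  have G'[measurable]: "?G \<in> sets \<gamma>" using G sets_\<gamma> by simp
  have pos: "(\<integral>\<^sup>+ z. e2ennreal (case z of (xh, x) \<Rightarrow> \<phi> xh x) \<partial>\<gamma>) = 0"
    by (auto simp: \<phi>_def e2ennreal_neg nn_integral_0_iff_AE split: prod.split intro!: nn_integral_zero')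
  \<comment> \<open>The negative part is \<infinity> times the indicator of the complement, so its
    integral is either 0 or \<infinity>, and \<open>gt\<close> rules out \<infinity>.\<close>
  have "(\<integral>\<^sup>+ z. e2ennreal (- (case z of (xh, x) \<Rightarrow> \<phi> xh x)) \<partial>\<gamma>) =
      (\<integral>\<^sup>+ z. top * indicator (space \<gamma> - ?G) z \<partial>\<gamma>)"
    by (intro nn_integral_cong) (auto simp: \<phi>_def split: split_indicator)
  also have "\<dots> = top * emeasure \<gamma> (space \<gamma> - ?G)"
    by (intro nn_integral_cmult_indicator) measurable
  finally have "emeasure \<gamma> (space \<gamma> - ?G) = 0"
    using gt pos
    by (cases "emeasure \<gamma> (space \<gamma> - ?G) = 0")
       (auto simp: ereal_expectation_def ennreal_top_mult zero_ennreal.rep_eq top_ennreal.rep_eq top_ereal_def)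
  then have "AE z in \<gamma>. z \<in> ?G"
    by (intro AE_I[where N = "space \<gamma> - ?G"]) auto
  then have "emeasure \<gamma> ?G = 1"
    using \<gamma>.emeasure_eq_1_AE[OF G'] by simp
  with \<gamma> show "\<exists>\<gamma>\<in>first_marginal_measures P. concentrated_on \<gamma> ?G"
    by (auto simp: concentrated_on_def)
qed

theorem proposition1:
  fixes P :: "'a measure"
  assumes "prob_space P"
  shows "(\<forall>\<phi>. diag_dominant_fun P \<phi> \<longrightarrow> interchangeable P \<phi>) \<longleftrightarrow>
         measurable_projection P \<and> weak_measurable_selection P"
  using interchangeable_if_projection_selection[OF assms]
    measurable_projection_if_interchangeable[of P] weak_measurable_selection_if_interchangeable[of P]
  by blast

end
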